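(* Let $p$ be a prime and let $q\in\mathbb{C}_p$ with $q\neq 1$ and $|1-q|_p<p^{-1/(p-1)}$. Let $n\in\mathbb{N}$ be a positive integer, let $w_1,\dots,w_n\in\mathbb{N}$ be positive integers, let $x\in\mathbb{Z}_p$, and let $t$ be a formal variable. For $\sigma\in S_n$ define the formal power series in $t$ over $\mathbb{C}_p$ $$A_\sigma(t)=\frac{1}{\left[\prod_{l=1}^{n-1}w_{\sigma(l)}\right]_q}\sum_{k_1=0}^{w_{\sigma(1)}-1}\cdots\sum_{k_{n-1}=0}^{w_{\sigma(n-1)}-1} q^{\,w_{\sigma(n)}\sum_{j=1}^{n-1}\left(\prod_{1\le i\le n-1,\, i\ne j}w_{\sigma(i)}\right)k_j}$$ $$\times\int_{\mathbb{Z}_p} e^{\left[\left(\prod_{j=1}^{n-1}w_{\sigma(j)}\right)y+\left(\prod_{j=1}^{n}w_j\right)x+w_{\sigma(n)}\sum_{j=1}^{n-1}\left(\prod_{1\le i\le n-1,\, i\neq j}w_{\sigma(i)}\right)k_j\right]_q t}\,d\mu_{q^{w_{\sigma(1)}\cdots w_{\sigma(n-1)}}}(y).$$ Then $A_\sigma(t)$ is the same for all $\sigma\in S_n$; that is, $A_\sigma(t)=A_\tau(t)$ for all $\sigma,\tau\in S_n$.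
   Context: $\mathbb{Z}_p$ is the ring of $p$-adic integers and $\mathbb{C}_p$ is the completion of an algebraic closure of $\mathbb{Q}_p$, with the $p$-adic norm normalized by $|p|_p=1/p$. $S_n$ is the symmetric group on $\{1,\dots,n\}$. For $q\in\mathbb{C}_p$ with $q\ne1$, $|1-q|_p<p^{-1/(p-1)}$, and $z\in\mathbb{Z}_p$, put $q^z=\exp(z\log q)$ ($p$-adic exponential and logarithm) and $[z]_q=\frac{1-q^z}{1-q}$. Every power $Q=q^w$ with $w$ a positive integer again satisfies $Q\neq1$ and $|1-Q|_p<p^{-1/(p-1)}$. For such $Q$ and a uniformly differentiable function $f:\mathbb{Z}_p\to\mathbb{C}_p$, the $p$-adic $Q$-integral is $$\int_{\mathbb{Z}_p}f(y)\,d\mu_Q(y)=\lim_{N\to\infty}\frac{1}{[p^N]_Q}\sum_{y=0}^{p^N-1}f(y)Q^y .$$ The exponential $e^{[\cdots]_q t}$ denotes the formal power series $\sum_{m\ge0}[\cdots]_q^m\frac{t^m}{m!}$ (with $0^0=1$), and the integral is taken coefficientwise in $t$. Empty products equal $1$ and empty sums in exponents or brackets equal $0$; when $n=1$ the multiple sum over $k_1,\dots,k_{n-1}$ consists of a single term. *)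

theory Defs
  imports
    "HOL-Analysis.Analysis"
    "HOL-Computational_Algebra.Computational_Algebra"
    "HOL-Combinatorics.Permutations"
begin

text \<open>
  Fields of characteristic 0 that are complete for a non-Archimedean absolute value \<open>vabs\<close>
  (definiteness of \<open>vabs\<close> follows from the metric axioms). The library's \<open>norm\<close> is
  restricted to real normed vector spaces and does not apply here. Limits, infinite
  sums and closures are the library's, for the metric \<open>vabs (x - y)\<close>.
\<close>

class complete_nonarch_field = field_char_0 + complete_space +
  fixes vabs :: "'a \<Rightarrow> real"
  assumes dist_vabs: "dist x y = vabs (x - y)"
    and vabs_mult: "vabs (x * y) = vabs x * vabs y"
    and vabs_add_le: "vabs (x + y) \<le> max (vabs x) (vabs y)"

definition Zp :: "'a::complete_nonarch_field set" where
  "Zp = closure \<int>"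

definition Qp :: "'a::complete_nonarch_field set" where
  "Qp = closure \<rat>"

definition Qp_bar :: "'a::complete_nonarch_field set" where
  "Qp_bar = {x. \<exists>f. f \<noteq> 0 \<and> (\<forall>i. coeff f i \<in> Qp) \<and> poly f x = 0}"

text \<open>
  The type \<open>'a\<close> is (a model of) \<open>\<complex>\<^sub>p\<close>. A non-Archimedean absolute value with
  \<open>\<bar>p\<bar> = 1/p\<close> restricts to the \<open>p\<close>-adic one on \<open>\<rat>\<close>, so in a complete field
  \<^const>\<open>Qp\<close> and \<^const>\<open>Zp\<close> are the completions of \<open>\<rat>\<close> and \<open>\<int>\<close>. The third
  conjunct makes \<^const>\<open>Qp_bar\<close>, which is algebraic over \<^const>\<open>Qp\<close> by definition, an
  algebraic closure of it, and the last one makes the complete field \<open>'a\<close> a completion of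
  that algebraic closure. This determines \<open>'a\<close> up to isometric isomorphism.
\<close>

definition is_Cp :: "'a::complete_nonarch_field itself \<Rightarrow> nat \<Rightarrow> bool" where
  "is_Cp _ p \<longleftrightarrow>
     prime p \<and>
     vabs (of_nat p :: 'a) = 1 / real p \<and>
     (\<forall>f :: 'a poly. degree f > 0 \<longrightarrow> (\<forall>i. coeff f i \<in> Qp_bar) \<longrightarrow>
        (\<exists>x\<in>Qp_bar. poly f x = 0)) \<and>
     closure (Qp_bar :: 'a set) = UNIV"

definition padic_exp :: "'a::complete_nonarch_field \<Rightarrow> 'a" where
  "padic_exp x = (\<Sum>k. x ^ k / fact k)"

definition padic_log :: "'a::complete_nonarch_field \<Rightarrow> 'a" where
  "padic_log x = (\<Sum>k. (-1) ^ k * (x - 1) ^ Suc k / of_nat (Suc k))"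

definition qpow :: "'a::complete_nonarch_field \<Rightarrow> 'a \<Rightarrow> 'a" where
  "qpow q z = padic_exp (z * padic_log q)"

definition qbracket :: "'a::complete_nonarch_field \<Rightarrow> 'a \<Rightarrow> 'a" where
  "qbracket q z = (1 - qpow q z) / (1 - q)"

text \<open>
  A function on \<open>\<int>\<^sub>p\<close> is represented by any function on \<open>'a\<close> extending it; the integral
  only uses its values on \<open>\<nat>\<close>. It is the stated limit whenever that limit exists, in
  particular for uniformly differentiable integrands, and unspecified otherwise.
\<close>

definition Qintegral ::
  "nat \<Rightarrow> 'a::complete_nonarch_field \<Rightarrow> ('a \<Rightarrow> 'a) \<Rightarrow> 'a" where
  "Qintegral p Q f =
     lim (\<lambda>N. 1 / qbracket Q (of_nat (p ^ N)) * (\<Sum>y<p ^ N. f (of_nat y) * Q ^ y))"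

definition fps_Qintegral ::
  "nat \<Rightarrow> 'a::complete_nonarch_field \<Rightarrow> ('a \<Rightarrow> 'a fps) \<Rightarrow> 'a fps" where
  "fps_Qintegral p Q F = Abs_fps (\<lambda>m. Qintegral p Q (\<lambda>y. fps_nth (F y) m))"

text \<open>
  The multiple sum over \<open>k\<^sub>1, \<dots>, k\<^sub>n\<^sub>-\<^sub>1\<close> is a sum over the tuples \<open>k\<close> in an
  extensional product (a singleton when \<open>n = 1\<close>). The term \<open>fps_exp a\<close> is the series
  \<open>\<Sum>m. a^m t^m / m!\<close>.
\<close>

definition A_series ::
  "nat \<Rightarrow> 'a::complete_nonarch_field \<Rightarrow> nat \<Rightarrow> (nat \<Rightarrow> nat) \<Rightarrow> 'a \<Rightarrow> (nat \<Rightarrow> nat) \<Rightarrow> 'a fps" where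
  "A_series p q n w x \<sigma> =
     (let W = (\<Prod>l\<in>{1..n-1}. w (\<sigma> l));
          e = (\<lambda>k. w (\<sigma> n) * (\<Sum>j\<in>{1..n-1}. (\<Prod>i\<in>{1..n-1} - {j}. w (\<sigma> i)) * k j))
      in fps_const (1 / qbracket q (of_nat W)) *
         (\<Sum>k \<in> (\<Pi>\<^sub>E j\<in>{1..n-1}. {0..<w (\<sigma> j)}).
            fps_const (q ^ e k) *
            fps_Qintegral p (q ^ W)
              (\<lambda>y. fps_exp (qbracket q
                 (of_nat W * y + of_nat (\<Prod>j\<in>{1..n}. w j) * x + of_nat (e k))))))"

end

theory Submission
  imports Defs
begin

text \<open>
  Expanding \<open>[\<dots>]\<^sub>q ^ m\<close> binomially turns the integrand into a combination of the
  exponentials \<open>Q ^ (l y)\<close>, \<open>l \<le> m\<close>, whose integrals are limits of geometric sums: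
  \<open>(l + 1) (1 - Q) / (1 - Q ^ (l + 1))\<close>. The sum over the \<open>k\<^sub>j\<close> is a product of geometric
  sums. With \<open>P = w\<^sub>1 \<dots> w\<^sub>n\<close> and \<open>Q = q ^ (P / w\<^bsub>\<sigma>(n)\<^esub>)\<close>, the denominator
  \<open>1 - Q ^ (l + 1)\<close> supplies exactly the factor missing from the product over \<open>j < n\<close>, so that
  \<open>\<sigma>\<close> enters only through
  \<open>(1 - q ^ ((l+1) P)) ^ (n-1) / (\<Prod>j=1..n. 1 - q ^ ((l+1) P / w\<^bsub>\<sigma>(j)\<^esub>))\<close>.
\<close>

section \<open>Non-Archimedean absolute values\<close>

lemma vabs_eq_dist: "vabs x = dist x (0::'a::complete_nonarch_field)"
  by (simp add: dist_vabs)

lemma vabs_nonneg [simp]: "vabs (x::'a::complete_nonarch_field) \<ge> 0"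
  by (simp add: vabs_eq_dist)

lemma vabs_eq_0_iff [simp]: "vabs (x::'a::complete_nonarch_field) = 0 \<longleftrightarrow> x = 0"
  by (simp add: vabs_eq_dist)

lemma vabs_le_0_iff [simp]: "vabs (x::'a::complete_nonarch_field) \<le> 0 \<longleftrightarrow> x = 0"
  by (simp add: vabs_eq_dist)

lemma vabs_0 [simp]: "vabs (0::'a::complete_nonarch_field) = 0"
  by simp

lemma vabs_pos_iff [simp]: "0 < vabs (x::'a::complete_nonarch_field) \<longleftrightarrow> x \<noteq> 0"
  by (simp add: vabs_eq_dist)

lemma vabs_1 [simp]: "vabs (1::'a::complete_nonarch_field) = 1"
  using vabs_mult[of "1::'a" 1] by auto

lemma vabs_minus [simp]: "vabs (- x) = vabs (x::'a::complete_nonarch_field)"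
proof -
  have "vabs (-1::'a) * vabs (-1::'a) = 1"
    by (simp flip: vabs_mult)
  then have "vabs (-1::'a) = 1"
    by (metis abs_of_nonneg real_sqrt_abs2 real_sqrt_one vabs_nonneg)
  then show ?thesis
    using vabs_mult[of "-1" x] by simp
qed

lemma vabs_power: "vabs (x ^ n) = vabs (x::'a::complete_nonarch_field) ^ n"
  by (induction n) (simp_all add: vabs_mult)

lemma vabs_divide: "vabs (x / y) = vabs x / vabs (y::'a::complete_nonarch_field)"
proof (cases "y = 0")
  case False
  have "vabs (x / y) * vabs y = vabs x"
    using False by (simp flip: vabs_mult)
  with False show ?thesis
    by (simp add: field_simps)
qed simp

lemma vabs_add_bound:
  fixes x y :: "'a::complete_nonarch_field"
  shows "vabs x \<le> B \<Longrightarrow> vabs y \<le> B \<Longrightarrow> vabs (x + y) \<le> B"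
  using vabs_add_le[of x y] by simp

lemma vabs_diff_bound:
  fixes x y :: "'a::complete_nonarch_field"
  shows "vabs x \<le> B \<Longrightarrow> vabs y \<le> B \<Longrightarrow> vabs (x - y) \<le> B"
  using vabs_add_bound[of x B "- y"] by simp

lemma vabs_diff_commute: "vabs (x - y) = vabs (y - (x::'a::complete_nonarch_field))"
  using vabs_minus[of "x - y"] by simp

text \<open>From x = (x + y) - y, |x| is at most max(|x + y|, |y|), and |y| < |x| rules out the
  second entry.\<close>

lemma vabs_add_eq_left:
  fixes x y :: "'a::complete_nonarch_field"
  assumes "vabs y < vabs x"
  shows "vabs (x + y) = vabs x"
proof (rule antisym)
  show "vabs (x + y) \<le> vabs x"
    using assms by (intro vabs_add_bound) auto
  show "vabs x \<le> vabs (x + y)"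
    using vabs_add_le[of "x + y" "- y"] assms by auto
qed

lemma vabs_sum_bound:
  fixes f :: "'b \<Rightarrow> 'a::complete_nonarch_field"
  assumes "0 \<le> B" "\<And>i. i \<in> A \<Longrightarrow> vabs (f i) \<le> B"
  shows "vabs (sum f A) \<le> B"
  using assms by (induction A rule: infinite_finite_induct) (auto intro: vabs_add_bound)

lemma vabs_of_nat_le_1 [simp]: "vabs (of_nat n :: 'a::complete_nonarch_field) \<le> 1"
  by (induction n) (auto intro: vabs_add_bound)

lemma vabs_of_int_le_1 [simp]: "vabs (of_int n :: 'a::complete_nonarch_field) \<le> 1"
  by (cases n) (auto simp del: of_nat_Suc)

section \<open>Limits and infinite series in the ultrametric topology\<close>

lemma tendsto_iff_vabs:
  fixes f :: "'b \<Rightarrow> 'a::complete_nonarch_field"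
  shows "(f \<longlongrightarrow> l) F \<longleftrightarrow> ((\<lambda>x. vabs (f x - l)) \<longlongrightarrow> 0) F"
  by (subst tendsto_dist_iff) (simp add: dist_vabs)

text \<open>Continuity of the ring operations, here and in the next instance, makes the limit rules
  behind \<open>tendsto_intros\<close> available on the type.\<close>

instance complete_nonarch_field \<subseteq> topological_semigroup_mult
proof
  fix a b :: 'a
  let ?F = "nhds a \<times>\<^sub>F nhds b"
  have *: "((\<lambda>x. vabs (fst x - a)) \<longlongrightarrow> 0) ?F" "((\<lambda>x. vabs (snd x - b)) \<longlongrightarrow> 0) ?F"
    by (simp_all flip: tendsto_iff_vabs add: filterlim_fst filterlim_snd)
  have "((\<lambda>x. vabs (fst x - a) * vabs (snd x - b) + vabs a * vabs (snd x - b)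
            + vabs (fst x - a) * vabs b) \<longlongrightarrow> 0 * 0 + vabs a * 0 + 0 * vabs b) ?F"
    by (intro tendsto_intros *)
  then have "((\<lambda>x. vabs (fst x - a) * vabs (snd x - b) + vabs a * vabs (snd x - b)
            + vabs (fst x - a) * vabs b) \<longlongrightarrow> 0) ?F"
    by simp
  then show "((\<lambda>x. fst x * snd x) \<longlongrightarrow> a * b) ?F"
    unfolding tendsto_iff_vabs
  proof (rule Lim_null_comparison[rotated], intro always_eventually allI)
    fix x :: "'a \<times> 'a"
    have "fst x * snd x - a * b = (fst x - a) * (snd x - b) + a * (snd x - b) + (fst x - a) * b"
      by (simp add: algebra_simps)
    also have "vabs \<dots> \<le> vabs (fst x - a) * vabs (snd x - b) + vabs a * vabs (snd x - b)
            + vabs (fst x - a) * vabs b"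
      by (intro vabs_add_bound) (simp_all add: vabs_mult)
    finally show "norm (vabs (fst x * snd x - a * b)) \<le> \<dots>"
      by simp
  qed
qed

instance complete_nonarch_field \<subseteq> topological_ab_group_add
proof
  fix a b :: 'a
  let ?F = "nhds a \<times>\<^sub>F nhds b"
  have *: "((\<lambda>x. vabs (fst x - a)) \<longlongrightarrow> 0) ?F" "((\<lambda>x. vabs (snd x - b)) \<longlongrightarrow> 0) ?F"
    by (simp_all flip: tendsto_iff_vabs add: filterlim_fst filterlim_snd)
  have "((\<lambda>x. vabs (fst x - a) + vabs (snd x - b)) \<longlongrightarrow> 0) ?F"
    using tendsto_add[OF *] by simp
  then show "((\<lambda>x. fst x + snd x) \<longlongrightarrow> a + b) ?F"
    unfolding tendsto_iff_vabs
  proof (rule Lim_null_comparison[rotated], intro always_eventually allI)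
    fix x :: "'a \<times> 'a"
    have "vabs ((fst x - a) + (snd x - b)) \<le> vabs (fst x - a) + vabs (snd x - b)"
      by (intro vabs_add_bound) simp_all
    then show "norm (vabs (fst x + snd x - (a + b))) \<le> vabs (fst x - a) + vabs (snd x - b)"
      by (simp add: algebra_simps)
  qed
next
  fix a :: 'a
  have "((\<lambda>x. x) \<longlongrightarrow> a) (nhds a)"
    by (rule filterlim_ident)
  then show "(uminus \<longlongrightarrow> - a) (nhds a)"
    unfolding tendsto_iff_vabs by (simp add: vabs_diff_commute)
qed

lemma vabs_le_limit:
  fixes f :: "nat \<Rightarrow> 'a::complete_nonarch_field"
  assumes "f \<longlonglongrightarrow> l" "eventually (\<lambda>n. vabs (f n) \<le> B) sequentially"
  shows "vabs l \<le> B"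
proof -
  have "(\<lambda>n. dist (f n) 0) \<longlonglongrightarrow> dist l 0"
    by (intro tendsto_intros assms)
  then show ?thesis
    using assms(2) unfolding vabs_eq_dist
    by (rule tendsto_upperbound) simp
qed

text \<open>A block of the series is bounded by its largest term, so in an ultrametric field null
  terms already make the partial sums Cauchy.\<close>

lemma nonarch_summable:
  fixes f :: "nat \<Rightarrow> 'a::complete_nonarch_field"
  assumes "f \<longlonglongrightarrow> 0"
  shows "summable f"
proof -
  have "Cauchy (\<lambda>n. sum f {..<n})"
    unfolding Cauchy_altdef
  proof (intro allI impI)
    fix e :: real assume "e > 0"
    then have "eventually (\<lambda>n. vabs (f n) < e / 2) sequentially"
      using tendstoD[OF assms, of "e / 2"] by (simp add: vabs_eq_dist)
    then obtain M where M: "\<And>n. n \<ge> M \<Longrightarrow> vabs (f n) < e / 2"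
      unfolding eventually_sequentially by blast
    have "dist (sum f {..<m}) (sum f {..<n}) < e" if "m \<ge> M" "n > m" for m n
    proof -
      have "sum f {..<n} = sum f {..<m} + sum f {m..<n}"
        using that by (metis atLeast0LessThan less_imp_le sum.atLeastLessThan_concat zero_le)
      \<comment> \<open>The bound on the block is only weak; \<open>e / 2\<close> buys the strict
        inequality.\<close>
      moreover have "vabs (sum f {m..<n}) \<le> e / 2"
        using that \<open>e > 0\<close> by (intro vabs_sum_bound less_imp_le[OF M]) auto
      ultimately show ?thesis
        using \<open>e > 0\<close> by (simp add: dist_vabs)
    qed
    then show "\<exists>M. \<forall>m\<ge>M. \<forall>n>m. dist (sum f {..<m}) (sum f {..<n}) < e"
      by blast
  qed
  then show ?thesis
    using Cauchy_convergent_iff convergent_def summable_iff_convergent by blast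
qed

text \<open>Every finite piece of the tail obeys the bound, and the bound survives the limit. The
  truncation estimates for exp and log below all cut their series with this.\<close>

lemma vabs_suminf_minus_sum_le:
  fixes f :: "nat \<Rightarrow> 'a::complete_nonarch_field"
  assumes "summable f" "0 \<le> B" "\<And>n. n \<ge> k \<Longrightarrow> vabs (f n) \<le> B"
  shows "vabs (suminf f - sum f {..<k}) \<le> B"
proof (rule vabs_le_limit)
  show "(\<lambda>n. sum f {..<n} - sum f {..<k}) \<longlonglongrightarrow> suminf f - sum f {..<k}"
    by (intro tendsto_intros summable_LIMSEQ assms)
  have "vabs (sum f {..<n} - sum f {..<k}) \<le> B" if "n \<ge> k" for n
  proof -
    have "sum f {..<n} = sum f {..<k} + sum f {k..<n}"
      using that by (metis atLeast0LessThan sum.atLeastLessThan_concat zero_le)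
    then show ?thesis
      using assms(2,3) by (auto intro!: vabs_sum_bound)
  qed
  then show "eventually (\<lambda>n. vabs (sum f {..<n} - sum f {..<k}) \<le> B) sequentially"
    by (auto simp: eventually_sequentially)
qed

lemma vabs_Zp_le_1:
  assumes "(x::'a::complete_nonarch_field) \<in> Zp"
  shows "vabs x \<le> 1"
proof -
  have "(\<int>::'a set) \<subseteq> cball 0 1"
    by (auto elim!: Ints_cases simp: dist_vabs)
  then have "closure (\<int>::'a set) \<subseteq> cball 0 1"
    by (rule closure_minimal) simp
  with assms show ?thesis
    by (auto simp: Zp_def dist_vabs)
qed

section \<open>The domain of convergence of the exponential\<close>

locale padic_valued =
  fixes p :: nat and ty :: "'a::complete_nonarch_field itself"
  assumes prime_p: "prime p"
    and vabs_p: "vabs (of_nat p :: 'a) = 1 / real p"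
begin

text \<open>The radius of convergence of the p-adic exponential.\<close>

definition \<rho> :: real where "\<rho> = real p powr (- 1 / (real p - 1))"

lemma p_ge_2: "p \<ge> 2"
  using prime_p by (rule prime_ge_2_nat)

lemma \<rho>_pos [simp]: "0 < \<rho>"
  using p_ge_2 by (simp add: \<rho>_def)

lemma \<rho>_nonneg [simp]: "0 \<le> \<rho>"
  by (rule less_imp_le) simp

lemma \<rho>_neq_0 [simp]: "\<rho> \<noteq> 0"
  using \<rho>_pos by linarith

lemma \<rho>_less_1: "\<rho> < 1"
  using p_ge_2 by (simp add: \<rho>_def powr_less_one)

lemma \<rho>_power: "\<rho> ^ (p - 1) = 1 / real p"
proof -
  have "\<rho> ^ (p - 1) = real p powr (- 1 / (real p - 1) * real (p - 1))"
    using p_ge_2 by (simp add: \<rho>_def powr_powr flip: powr_realpow)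
  also have "- 1 / (real p - 1) * real (p - 1) = - 1"
    using p_ge_2 by (simp add: of_nat_diff)
  finally show ?thesis
    using p_ge_2 by (simp add: powr_minus_divide)
qed

section \<open>Absolute values of integers and factorials\<close>

lemma vabs_of_nat_coprime:
  assumes "\<not> p dvd k"
  shows "vabs (of_nat k :: 'a) = 1"
proof (rule antisym)
  \<comment> \<open>Bezout: in a k + b p = 1 the term b p has absolute value below 1, which forces
    that of a k to be at least 1.\<close>
  have "coprime (int k) (int p)"
    using prime_imp_coprime_nat[OF prime_p assms] by (simp add: coprime_commute)
  then obtain a b where "a * int k + b * int p = 1"
    by (metis bezout_int coprime_iff_gcd_eq_1)
  then have 1: "of_int a * of_nat k + of_int b * of_nat p = (1::'a)"
    by (metis of_int_1 of_int_add of_int_mult of_int_of_nat_eq)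
  have 2: "vabs (of_int b * of_nat p :: 'a) < 1"
    using mult_right_mono[OF vabs_of_int_le_1[of b, where 'a='a], of "1 / real p"] p_ge_2
    by (simp add: vabs_mult vabs_p order_le_less_trans)
  have "1 \<le> vabs (of_int a * of_nat k :: 'a)"
    using vabs_add_le[of "of_int a * of_nat k :: 'a" "of_int b * of_nat p"] 1 2 by auto
  also have "\<dots> \<le> 1 * vabs (of_nat k :: 'a)"
    unfolding vabs_mult by (intro mult_right_mono) auto
  finally show "1 \<le> vabs (of_nat k :: 'a)"
    by simp
qed simp

lemma vabs_fact_block:
  assumes "r < p"
  shows "vabs (fact (p * m + r) :: 'a) = vabs (fact (p * m) :: 'a)"
  using assms
proof (induction r)
  case (Suc r)
  have "\<not> p dvd (p * m + Suc r)"
    using Suc.prems by (auto simp: dvd_add_right_iff dest: dvd_imp_le simp del: add_Suc_right)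
  from vabs_of_nat_coprime[OF this] Suc show ?case
    by (simp add: vabs_mult del: of_nat_Suc of_nat_add)
qed simp

text \<open>Legendre's formula one level deep: among the factors of (p m)! only the m multiples of p
  matter, and their quotients by p make up m!.\<close>

lemma vabs_fact_mult: "vabs (fact (p * m) :: 'a) = (1 / real p) ^ m * vabs (fact m :: 'a)"
proof (induction m)
  case (Suc m)
  have eq: "p * Suc m = Suc (p * m + (p - 1))"
    using p_ge_2 by simp
  have "vabs (fact (p * Suc m) :: 'a) = vabs (of_nat (p * Suc m) * fact (p * m + (p - 1)) :: 'a)"
    by (metis eq fact_Suc)
  also have "\<dots> = 1 / real p * vabs (of_nat (Suc m) :: 'a) * vabs (fact (p * m) :: 'a)"
    using vabs_fact_block[of "p - 1" m] p_ge_2 by (simp only: vabs_mult of_nat_mult vabs_p)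
  finally show ?case
    unfolding Suc by (simp add: vabs_mult del: of_nat_Suc)
qed simp

text \<open>This is v_p((k+1)!) <= k / (p - 1). Dividing k + 1 by p trades each multiple of p for
  \<open>\<rho> ^ (p - 1)\<close> and leaves the factorial of the smaller quotient, to which
  induction applies.\<close>

lemma vabs_fact_ge: "\<rho> ^ k \<le> vabs (fact (Suc k) :: 'a)"
proof (induction k rule: less_induct)
  case (less k)
  define m r where "m = Suc k div p" and "r = Suc k mod p"
  have k: "Suc k = p * m + r" and r: "r < p"
    using p_ge_2 by (simp_all add: m_def r_def)
  have eq: "vabs (fact (Suc k) :: 'a) = (\<rho> ^ (p - 1)) ^ m * vabs (fact m :: 'a)"
    unfolding k using r by (simp only: vabs_fact_block vabs_fact_mult \<rho>_power)
  show ?case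
  proof (cases m)
    case 0
    then show ?thesis
      unfolding eq using \<rho>_less_1 by (simp add: power_le_one less_imp_le)
  next
    case (Suc j)
    \<comment> \<open>With m = j + 1 the exponent (p - 1) m + j equals p m - 1, which is at most
      k.\<close>
    have "p * m = (p - 1) * m + m"
      using p_ge_2 by (simp add: algebra_simps diff_mult_distrib)
    then have *: "(p - 1) * m + j \<le> k"
      using k Suc by linarith
    have "m < Suc k"
      unfolding m_def using p_ge_2 by (intro div_less_dividend) auto
    then have "\<rho> ^ j \<le> vabs (fact m :: 'a)"
      unfolding Suc by (intro less) simp
    then have "\<rho> ^ ((p - 1) * m + j) \<le> (\<rho> ^ (p - 1)) ^ m * vabs (fact m :: 'a)"
      by (simp add: power_add power_mult)
    moreover have "\<rho> ^ k \<le> \<rho> ^ ((p - 1) * m + j)"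
      using * \<rho>_less_1 by (intro power_decreasing) auto
    ultimately show ?thesis
      unfolding eq by linarith
  qed
qed

text \<open>As |k!| is at most 1, |k + 1| is at least |(k + 1)!|, so the factorial bound serves the
  denominators of the logarithm too.\<close>

lemma vabs_of_nat_Suc_ge: "\<rho> ^ k \<le> vabs (of_nat (Suc k) :: 'a)"
proof -
  have "vabs (of_nat (Suc k) * of_nat (fact k) :: 'a) \<le> vabs (of_nat (Suc k) :: 'a)"
    unfolding vabs_mult by (intro mult_left_le) (auto simp del: of_nat_fact of_nat_Suc)
  then show ?thesis
    using vabs_fact_ge[of k] by (simp del: of_nat_Suc)
qed

text \<open>Shared by exp and log, whose denominators at degree k + 1 are at least
  \<open>\<rho> ^ k\<close>. Keeping one factor |z| apart leaves a geometric sequence, with ratio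
  below 1 when |z| < \<rho>.\<close>

lemma term_bound:
  assumes "\<rho> ^ k \<le> vabs (d::'a)"
  shows "vabs (z ^ Suc k / d) \<le> vabs z * (vabs z / \<rho>) ^ k"
proof -
  have "vabs (z ^ Suc k / d) \<le> vabs z ^ Suc k / \<rho> ^ k"
    unfolding vabs_divide vabs_power
    using assms less_le_trans[OF zero_less_power[OF \<rho>_pos] assms]
    by (intro divide_left_mono mult_pos_pos) auto
  then show ?thesis
    by (simp add: power_divide)
qed

lemmas vabs_exp_term_le = term_bound[OF vabs_fact_ge]
lemmas vabs_log_term_le = term_bound[OF vabs_of_nat_Suc_ge]

lemma tendsto_geometric_bound:
  assumes "vabs z < \<rho>" "\<And>k. vabs (f k :: 'a) \<le> vabs (z::'a) * (vabs z / \<rho>) ^ k"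
  shows "f \<longlonglongrightarrow> 0"
proof -
  have "(\<lambda>k. vabs z * (vabs z / \<rho>) ^ k) \<longlonglongrightarrow> vabs z * 0"
    using assms(1) by (intro tendsto_intros LIMSEQ_realpow_zero) (auto simp: less_imp_le)
  then show ?thesis
    unfolding tendsto_iff_vabs using assms(2)
    by (intro Lim_null_comparison[of "\<lambda>k. vabs (f k - 0)"]) auto
qed

lemma ratio_power_le:
  assumes "vabs (z::'a) < \<rho>" "j \<le> k"
  shows "vabs z * (vabs z / \<rho>) ^ k \<le> vabs z * (vabs z / \<rho>) ^ j"
  using assms by (intro mult_left_mono power_decreasing) auto

lemma exp_summable:
  assumes "vabs (z::'a) < \<rho>"
  shows "summable (\<lambda>k. z ^ k / fact k)"
proof -
  have "(\<lambda>k. z ^ Suc k / fact (Suc k)) \<longlonglongrightarrow> 0"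
    by (rule tendsto_geometric_bound[OF assms vabs_exp_term_le])
  then show ?thesis
    by (intro nonarch_summable) (rule LIMSEQ_imp_Suc)
qed

lemma log_term_le:
  "vabs ((-1) ^ k * z ^ Suc k / of_nat (Suc k) :: 'a) \<le> vabs z * (vabs z / \<rho>) ^ k"
  using vabs_log_term_le[of z k]
  by (simp add: vabs_mult vabs_divide vabs_power del: of_nat_Suc)

lemma log_summable:
  assumes "vabs (z::'a) < \<rho>"
  shows "summable (\<lambda>k. (-1) ^ k * z ^ Suc k / of_nat (Suc k))"
  using tendsto_geometric_bound[OF assms log_term_le] by (rule nonarch_summable)

text \<open>The error is quadratic in z, so for z = p^N L it stays negligible after division by
  p^N.\<close>

lemma vabs_exp_minus_linear_le:
  assumes "vabs (z::'a) < \<rho>"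
  shows "vabs (padic_exp z - (1 + z)) \<le> vabs z * (vabs z / \<rho>)"
proof -
  have "vabs ((\<Sum>k. z ^ k / fact k) - (\<Sum>k<2. z ^ k / fact k)) \<le> vabs z * (vabs z / \<rho>)"
  proof (rule vabs_suminf_minus_sum_le[OF exp_summable[OF assms]])
    fix n :: nat assume "n \<ge> 2"
    then obtain k where k: "n = Suc k" "k \<ge> 1"
      by (cases n) auto
    show "vabs (z ^ n / fact n) \<le> vabs z * (vabs z / \<rho>)"
      unfolding k using vabs_exp_term_le[of z k] ratio_power_le[OF assms k(2)] by simp
  qed auto
  then show ?thesis
    by (simp add: padic_exp_def numeral_2_eq_2)
qed

lemma vabs_exp_minus_1_le:
  assumes "vabs (z::'a) < \<rho>"
  shows "vabs (padic_exp z - 1) \<le> vabs z"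
proof -
  have "vabs z * (vabs z / \<rho>) \<le> vabs z"
    using ratio_power_le[OF assms, of 0 1] by simp
  with vabs_exp_minus_linear_le[OF assms] have "vabs (padic_exp z - (1 + z)) \<le> vabs z"
    by linarith
  from vabs_add_bound[OF this order_refl] show ?thesis
    by simp
qed

lemma vabs_log_le:
  assumes "vabs (u::'a) < \<rho>"
  shows "vabs (padic_log (1 + u)) \<le> vabs u"
proof -
  have "vabs (padic_log (1 + u) - (\<Sum>k<0. (-1) ^ k * u ^ Suc k / of_nat (Suc k))) \<le> vabs u"
    unfolding padic_log_def add_diff_cancel_left'
  proof (rule vabs_suminf_minus_sum_le[OF log_summable[OF assms]])
    fix n
    show "vabs ((-1) ^ n * u ^ Suc n / of_nat (Suc n)) \<le> vabs u"
      using log_term_le[of n u] ratio_power_le[OF assms, of 0 n] by simp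
  qed auto
  then show ?thesis
    by simp
qed

section \<open>Exponential and logarithm\<close>

lemma padic_exp_0 [simp]: "padic_exp 0 = (1::'a)"
  using vabs_exp_minus_1_le[of 0] by simp

text \<open>The majorant s^k is multiplicative in the degree, as the Cauchy product requires; the
  separate factor |z| is absorbed using \<rho> < 1.\<close>

lemma exp_term_le:
  assumes "vabs (z::'a) \<le> \<rho> * s"
  shows "vabs (z ^ k / fact k) \<le> s ^ k"
proof (cases k)
  case (Suc j)
  have s: "vabs z / \<rho> \<le> s"
    using assms by (simp add: field_simps)
  have "vabs z \<le> vabs z / \<rho>"
    using \<rho>_less_1 mult_left_le[of \<rho> "vabs z"] by (simp add: field_simps)
  then have "vabs z * (vabs z / \<rho>) ^ j \<le> (vabs z / \<rho>) ^ Suc j"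
    unfolding power_Suc by (intro mult_right_mono) auto
  also have "\<dots> \<le> s ^ Suc j"
    using s by (intro power_mono) auto
  finally show ?thesis
    using vabs_exp_term_le[of z j] unfolding Suc by linarith
qed simp

text \<open>The product of the K-th partial sums differs from the K-th partial sum of the Cauchy
  product by terms of total degree at least K, each at most s^K.\<close>

lemma padic_exp_add:
  assumes a: "vabs (a::'a) < \<rho>" and b: "vabs b < \<rho>"
  shows "padic_exp (a + b) = padic_exp a * padic_exp b"
proof -
  define s where "s = max (vabs a) (vabs b) / \<rho>"
  have s: "0 \<le> s" "s < 1" "vabs a \<le> \<rho> * s" "vabs b \<le> \<rho> * s"
    using a b by (auto simp: s_def le_max_iff_disj)
  define S where "S z k = z ^ k / fact k" for z :: 'a and k
  have S_limit: "(\<lambda>K. \<Sum>k<K. S z k) \<longlonglongrightarrow> padic_exp z" if "vabs z < \<rho>" for z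
    unfolding S_def padic_exp_def by (rule summable_LIMSEQ[OF exp_summable[OF that]])
  \<comment> \<open>The binomial theorem for the terms, read off as a coefficient of the identity of
    formal exponentials.\<close>
  have S_add: "S (a + b) k = (\<Sum>i\<le>k. S a i * S b (k - i))" for k
    using arg_cong[OF fps_exp_add_mult[of a b], of "\<lambda>f. fps_nth f k"]
    by (simp add: S_def fps_mult_nth atLeast0AtMost)
  have bound: "vabs ((\<Sum>k<K. S a k) * (\<Sum>k<K. S b k) - (\<Sum>k<K. S (a + b) k)) \<le> s ^ K" for K
  proof -
    let ?T = "{(i, j). i + j < K}"
    have sub: "?T \<subseteq> {..<K} \<times> {..<K}"
      by auto
    have "(\<Sum>k<K. S a k) * (\<Sum>k<K. S b k) = (\<Sum>(i, j)\<in>{..<K} \<times> {..<K}. S a i * S b j)"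
      by (simp add: sum_product sum.cartesian_product)
    moreover have "(\<Sum>k<K. S (a + b) k) = (\<Sum>(i, j)\<in>?T. S a i * S b j)"
      by (simp add: S_add sum.triangle_reindex)
    ultimately have eq: "(\<Sum>k<K. S a k) * (\<Sum>k<K. S b k) - (\<Sum>k<K. S (a + b) k)
        = (\<Sum>(i, j)\<in>{..<K} \<times> {..<K} - ?T. S a i * S b j)"
      using sub by (simp add: sum_diff)
    show ?thesis
      unfolding eq
    proof (rule vabs_sum_bound)
      fix ij assume "ij \<in> {..<K} \<times> {..<K} - ?T"
      then obtain i j where ij: "ij = (i, j)" "\<not> i + j < K"
        by auto
      have "vabs (S a i * S b j) \<le> s ^ i * s ^ j"
        unfolding vabs_mult S_def using s by (intro mult_mono exp_term_le) auto
      also have "\<dots> \<le> s ^ K"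
        using s ij(2) by (simp flip: power_add add: power_decreasing)
      finally show "vabs (case ij of (i, j) \<Rightarrow> S a i * S b j) \<le> s ^ K"
        by (simp add: ij(1))
    qed (use s in simp)
  qed
  have "(\<lambda>K. s ^ K) \<longlonglongrightarrow> 0"
    using s by (intro LIMSEQ_realpow_zero)
  then have "(\<lambda>K. (\<Sum>k<K. S a k) * (\<Sum>k<K. S b k) - (\<Sum>k<K. S (a + b) k)) \<longlonglongrightarrow> 0"
    unfolding tendsto_iff_vabs
    by (rule Lim_null_comparison[rotated]) (simp add: bound always_eventually)
  moreover have "(\<lambda>K. (\<Sum>k<K. S a k) * (\<Sum>k<K. S b k) - (\<Sum>k<K. S (a + b) k))
      \<longlonglongrightarrow> padic_exp a * padic_exp b - padic_exp (a + b)"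
    using a b vabs_add_le[of a b] by (intro tendsto_intros S_limit) auto
  ultimately show ?thesis
    using LIMSEQ_unique by fastforce
qed

lemma vabs_scaled_less:
  assumes "vabs c \<le> 1" "vabs (z::'a) < \<rho>"
  shows "vabs (c * z) < \<rho>"
  unfolding vabs_mult using assms mult_right_mono[of "vabs c" 1 "vabs z"] by simp

lemma padic_exp_of_nat_mult:
  assumes "vabs (z::'a) < \<rho>"
  shows "padic_exp (of_nat n * z) = padic_exp z ^ n"
proof (induction n)
  case (Suc n)
  have "padic_exp (z + of_nat n * z) = padic_exp z * padic_exp (of_nat n * z)"
    using assms by (intro padic_exp_add vabs_scaled_less) auto
  then show ?case
    using Suc by (simp add: distrib_right)
qed simp

section \<open>The logarithm as the limit of ((1 + u)^(p^N) - 1) / p^N\<close>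

lemma power_Suc_expand:
  "(1 + u) ^ Suc m - 1
     = of_nat (Suc m) * (\<Sum>k\<le>m. of_nat (m choose k) * (u ^ Suc k / of_nat (Suc k)) :: 'a)"
proof -
  have "(1 + u) ^ Suc m = (\<Sum>k\<le>Suc m. of_nat (Suc m choose k) * u ^ k)"
    using binomial_ring[of u 1 "Suc m"] by (simp add: add.commute)
  also have "\<dots> = 1 + (\<Sum>k\<le>m. of_nat (Suc m choose Suc k) * u ^ Suc k)"
    by (subst sum.atMost_Suc_shift) simp
  \<comment> \<open>Absorption, (k+1) C(m+1,k+1) = (m+1) C(m,k), extracts the exponent m + 1. What
    is left is the log series with each sign (-1)^k replaced by C(m,k).\<close>
  also have "(\<Sum>k\<le>m. of_nat (Suc m choose Suc k) * u ^ Suc k)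
      = (\<Sum>k\<le>m. of_nat (Suc m) * (of_nat (m choose k) * (u ^ Suc k / of_nat (Suc k))))"
  proof (rule sum.cong[OF refl])
    fix k
    have "of_nat (Suc m choose Suc k) = (of_nat (Suc m) * of_nat (m choose k) / of_nat (Suc k) :: 'a)"
      using arg_cong[OF Suc_times_binomial[of k m], of "of_nat :: nat \<Rightarrow> 'a"]
      by (simp only: of_nat_mult) (metis nonzero_mult_div_cancel_left of_nat_neq_0)
    then show "of_nat (Suc m choose Suc k) * u ^ Suc k
        = of_nat (Suc m) * (of_nat (m choose k) * (u ^ Suc k / of_nat (Suc k)))"
      by (simp only:) simp
  qed
  finally show ?thesis
    by (simp add: sum_distrib_left)
qed

text \<open>Once the exponent is factored out, the degree 1 term u strictly dominates: every other
  term is at most |u| times the ratio |u| / \<rho> < 1.\<close>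

lemma vabs_power_minus_1:
  assumes "vabs ((q::'a) - 1) < \<rho>"
  shows "vabs (q ^ a - 1) = vabs (of_nat a :: 'a) * vabs (q - 1)"
proof (cases "a = 0 \<or> q = 1")
  case False
  then obtain m where m: "a = Suc m"
    by (cases a) auto
  define u where "u = q - 1"
  have u: "vabs u < \<rho>" "u \<noteq> 0" "q = 1 + u"
    using False assms by (auto simp: u_def)
  let ?f = "\<lambda>k. of_nat (m choose k) * (u ^ Suc k / of_nat (Suc k)) :: 'a"
  have "vabs (\<Sum>k\<in>{..m} - {0}. ?f k) \<le> vabs u * (vabs u / \<rho>)"
  proof (rule vabs_sum_bound)
    fix k assume "k \<in> {..m} - {0}"
    have "vabs (?f k) \<le> 1 * vabs (u ^ Suc k / of_nat (Suc k))"
      unfolding vabs_mult by (intro mult_right_mono) auto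
    also have "\<dots> \<le> vabs u * (vabs u / \<rho>)"
      using vabs_log_term_le[of u k] ratio_power_le[OF u(1), of 1 k] \<open>k \<in> _\<close> by simp
    finally show "vabs (?f k) \<le> vabs u * (vabs u / \<rho>)" .
  qed simp
  also have "\<dots> < vabs u * 1"
    using u by (intro mult_strict_left_mono) auto
  finally have "vabs (u + (\<Sum>k\<in>{..m} - {0}. ?f k)) = vabs u"
    by (intro vabs_add_eq_left) simp
  moreover have "(\<Sum>k\<le>m. ?f k) = u + (\<Sum>k\<in>{..m} - {0}. ?f k)"
    by (subst sum.remove[of _ 0]) auto
  ultimately show ?thesis
    unfolding m u(3) power_Suc_expand by (simp add: vabs_mult del: of_nat_Suc)
qed auto

text \<open>Since C(-1,k) = (-1)^k, the difference should be small when m + 1 is p-adically small.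
  Pascal's rule reduces the induction step to a bound on C(m+1,k+1) = C(m,k) (m+1)/(k+1).\<close>

lemma vabs_binomial_minus_sign_le:
  "vabs (of_nat (m choose k) - (-1) ^ k :: 'a) \<le> vabs (of_nat (Suc m) :: 'a) / \<rho> ^ k"
proof (induction k)
  case (Suc k)
  have mono: "vabs (of_nat (Suc m) :: 'a) / \<rho> ^ k \<le> vabs (of_nat (Suc m) :: 'a) / \<rho> ^ Suc k"
    using \<rho>_less_1 by (intro divide_left_mono power_decreasing) auto
  have "vabs (of_nat (Suc k) :: 'a) * vabs (of_nat (Suc m choose Suc k) :: 'a)
      = vabs (of_nat (Suc m) :: 'a) * vabs (of_nat (m choose k) :: 'a)"
    by (metis Suc_times_binomial of_nat_mult vabs_mult)
  also have "\<dots> \<le> vabs (of_nat (Suc m) :: 'a)"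
    by (intro mult_left_le) auto
  finally have "\<rho> ^ k * vabs (of_nat (Suc m choose Suc k) :: 'a) \<le> vabs (of_nat (Suc m) :: 'a)"
    using mult_right_mono[OF vabs_of_nat_Suc_ge[of k] vabs_nonneg] by (rule order_trans[rotated])
  then have "vabs (of_nat (Suc m choose Suc k) :: 'a) \<le> vabs (of_nat (Suc m) :: 'a) / \<rho> ^ k"
    by (simp add: field_simps del: of_nat_Suc binomial_Suc_Suc)
  from vabs_diff_bound[OF this Suc] mono show ?case
    by (simp add: algebra_simps del: of_nat_Suc)
qed simp

text \<open>Term by term: below index K the coefficients C(m,k) and (-1)^k are close, from K on the
  terms themselves are small. K stays free because it has to be fixed before m + 1 tends to
  0.\<close>

lemma vabs_power_quotient_minus_log_le:
  assumes u: "vabs (u::'a) < \<rho>"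
  shows "vabs (padic_log (1 + u) - ((1 + u) ^ Suc m - 1) / of_nat (Suc m))
           \<le> max (vabs u * (vabs u / \<rho>) ^ K) (vabs u * (vabs (of_nat (Suc m) :: 'a) / \<rho> ^ K))"
    (is "_ \<le> ?B")
proof -
  define t where "t k = u ^ Suc k / of_nat (Suc k)" for k
  \<comment> \<open>Past K the log tail obeys the bound, and past m the binomials vanish, so cutting
    at J keeps the whole quotient.\<close>
  define J where "J = max K (Suc m)"
  have t_le: "vabs (t k) \<le> vabs u * (vabs u / \<rho>) ^ k" for k
    unfolding t_def by (rule vabs_log_term_le)
  have B: "0 \<le> ?B" "vabs u * (vabs u / \<rho>) ^ K \<le> ?B"
    by (auto simp: le_max_iff_disj)
  have "((1 + u) ^ Suc m - 1) / of_nat (Suc m) = (\<Sum>k\<le>m. of_nat (m choose k) * t k)"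
    unfolding power_Suc_expand t_def by (simp del: of_nat_Suc)
  also have "\<dots> = (\<Sum>k<J. of_nat (m choose k) * t k)"
    by (rule sum.mono_neutral_left) (auto simp: J_def)
  finally have quot: "((1 + u) ^ Suc m - 1) / of_nat (Suc m) = (\<Sum>k<J. of_nat (m choose k) * t k)" .
  have log: "padic_log (1 + u) = (\<Sum>k. (-1) ^ k * t k)"
    by (simp add: padic_log_def t_def)
  have "vabs ((\<Sum>k. (-1) ^ k * t k) - (\<Sum>k<J. (-1) ^ k * t k)) \<le> ?B"
  proof (rule vabs_suminf_minus_sum_le)
    show "summable (\<lambda>k. (-1) ^ k * t k)"
      using log_summable[OF u] by (simp add: t_def)
    fix k assume "J \<le> k"
    then show "vabs ((-1) ^ k * t k) \<le> ?B"
      using t_le[of k] ratio_power_le[OF u, of K k] B(2)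
      by (simp add: vabs_mult vabs_power J_def)
  qed (rule B)
  moreover have "vabs (\<Sum>k<J. (of_nat (m choose k) - (-1) ^ k) * t k) \<le> ?B"
  proof (rule vabs_sum_bound)
    fix k
    let ?c = "of_nat (m choose k) - (-1) ^ k :: 'a"
    show "vabs (?c * t k) \<le> ?B"
    proof (cases "k < K")
      case True
      have "vabs (of_nat (Suc m) :: 'a) / \<rho> ^ k \<le> vabs (of_nat (Suc m) :: 'a) / \<rho> ^ K"
        using \<rho>_less_1 True by (intro divide_left_mono power_decreasing) auto
      then have "vabs ?c \<le> vabs (of_nat (Suc m) :: 'a) / \<rho> ^ K"
        using vabs_binomial_minus_sign_le[of m k] by linarith
      moreover have "vabs (t k) \<le> vabs u"
        using t_le[of k] ratio_power_le[OF u, of 0 k] by simp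
      ultimately have "vabs (?c * t k) \<le> vabs (of_nat (Suc m) :: 'a) / \<rho> ^ K * vabs u"
        unfolding vabs_mult by (intro mult_mono) auto
      then show ?thesis
        by (simp add: mult.commute le_max_iff_disj del: of_nat_Suc)
    next
      case False
      have "vabs ?c \<le> 1"
        by (intro vabs_diff_bound) (simp_all add: vabs_power)
      then have "vabs (?c * t k) \<le> 1 * vabs (t k)"
        unfolding vabs_mult by (intro mult_right_mono) auto
      then show ?thesis
        using t_le[of k] ratio_power_le[OF u, of K k] B(2) False by linarith
    qed
  qed (rule B)
  ultimately have "vabs ((\<Sum>k. (-1) ^ k * t k) - (\<Sum>k<J. (-1) ^ k * t k)
      - (\<Sum>k<J. (of_nat (m choose k) - (-1) ^ k) * t k)) \<le> ?B"
    by (rule vabs_diff_bound)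
  then show ?thesis
    unfolding log quot by (simp add: left_diff_distrib sum_subtractf)
qed

lemma vabs_p_power: "vabs (of_nat (p ^ N) :: 'a) = (1 / real p) ^ N"
  by (simp add: vabs_power vabs_p)

lemma p_power_tendsto_0: "(\<lambda>N. vabs (of_nat (p ^ N) :: 'a)) \<longlonglongrightarrow> 0"
  unfolding vabs_p_power using p_ge_2 by (intro LIMSEQ_realpow_zero) auto

lemma power_quotient_tendsto_log:
  assumes u: "vabs (u::'a) < \<rho>"
  shows "(\<lambda>N. ((1 + u) ^ (p ^ N) - 1) / of_nat (p ^ N)) \<longlonglongrightarrow> padic_log (1 + u)"
proof (rule tendstoI)
  fix e :: real assume "e > 0"
  have "(\<lambda>K. vabs u * (vabs u / \<rho>) ^ K) \<longlonglongrightarrow> vabs u * 0"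
    using u by (intro tendsto_intros LIMSEQ_realpow_zero) (auto simp: less_imp_le)
  then have "eventually (\<lambda>K. vabs u * (vabs u / \<rho>) ^ K < e) sequentially"
    using \<open>e > 0\<close> by (intro order_tendstoD) auto
  then obtain K where K: "vabs u * (vabs u / \<rho>) ^ K < e"
    by (auto simp: eventually_sequentially)
  have "(\<lambda>N. vabs u * (vabs (of_nat (p ^ N) :: 'a) / \<rho> ^ K)) \<longlonglongrightarrow> vabs u * (0 / \<rho> ^ K)"
    by (intro tendsto_intros p_power_tendsto_0) auto
  then have "eventually (\<lambda>N. vabs u * (vabs (of_nat (p ^ N) :: 'a) / \<rho> ^ K) < e) sequentially"
    using \<open>e > 0\<close> by (intro order_tendstoD) auto
  then show "eventually (\<lambda>N. dist (((1 + u) ^ (p ^ N) - 1) / of_nat (p ^ N)) (padic_log (1 + u)) < e)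
      sequentially"
  proof eventually_elim
    case (elim N)
    have "p ^ N = Suc (p ^ N - 1)"
      using p_ge_2 by simp
    with vabs_power_quotient_minus_log_le[OF u, of "p ^ N - 1" K] elim K show ?case
      by (simp only: dist_vabs vabs_diff_commute)
  qed
qed

text \<open>For \<open>r = exp (log q) / q\<close> and \<open>M = p ^ N\<close>, both \<open>exp (M log q)\<close> and \<open>q ^ M\<close> are
  \<open>1 + M log q\<close> up to \<open>o(M)\<close>, whereas \<open>\<bar>r ^ M - 1\<bar> = \<bar>M\<bar> \<bar>r - 1\<bar>\<close>. Hence \<open>r = 1\<close>.\<close>

lemma padic_exp_log:
  assumes "vabs ((q::'a) - 1) < \<rho>"
  shows "padic_exp (padic_log q) = q"
proof -
  define u where "u = q - 1"
  have u: "vabs u < \<rho>" "q = 1 + u"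
    using assms by (auto simp: u_def)
  define L where "L = padic_log q"
  have L_le: "vabs L \<le> vabs u"
    unfolding L_def u(2) by (rule vabs_log_le[OF u(1)])
  then have L: "vabs L < \<rho>"
    using u by simp
  have q1: "vabs q = 1"
    unfolding u(2) using u(1) \<rho>_less_1 vabs_add_eq_left[of u 1] by simp
  then have "q \<noteq> 0"
    by auto
  define r where "r = padic_exp L / q"
  \<comment> \<open>exp L and q both lie within |u| of 1 and |q| = 1, so r lies in the disc where
    \<open>vabs_power_minus_1\<close> applies.\<close>
  have "vabs (padic_exp L - 1) \<le> vabs u"
    using vabs_exp_minus_1_le[OF L] L_le by linarith
  from vabs_diff_bound[OF this order_refl] have "vabs (padic_exp L - q) \<le> vabs u"
    by (simp add: u(2) algebra_simps)
  moreover have "r - 1 = (padic_exp L - q) / q"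
    using \<open>q \<noteq> 0\<close> by (simp add: r_def field_simps)
  ultimately have r: "vabs (r - 1) < \<rho>"
    using u(1) by (simp add: vabs_divide q1)
  define M where "M N = (of_nat (p ^ N) :: 'a)" for N
  have M0: "M N \<noteq> 0" for N
    using p_ge_2 by (simp add: M_def)
  \<comment> \<open>a is the scaled first-order error of exp(M L) and b the quotient tending to L,
    chosen so that a + (L - b) = (exp(M L) - q^M) / M.\<close>
  define a where "a N = (padic_exp (M N * L) - (1 + M N * L)) / M N" for N
  define b where "b N = (q ^ (p ^ N) - 1) / M N" for N
  have a_le: "vabs (a N) \<le> vabs (M N) * (vabs L * (vabs L / \<rho>))" for N
  proof -
    have "vabs (M N * L) < \<rho>"
      using L by (intro vabs_scaled_less) (simp_all add: M_def del: of_nat_power)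
    from vabs_exp_minus_linear_le[OF this] M0[of N] show ?thesis
      by (simp add: a_def vabs_divide vabs_mult field_simps less_le)
  qed
  have "(\<lambda>N. vabs (M N) * (vabs L * (vabs L / \<rho>))) \<longlonglongrightarrow> 0 * (vabs L * (vabs L / \<rho>))"
    unfolding M_def by (intro tendsto_intros p_power_tendsto_0)
  then have "(\<lambda>N. vabs (M N) * (vabs L * (vabs L / \<rho>))) \<longlonglongrightarrow> 0"
    by (simp only: mult_zero_left)
  then have "a \<longlonglongrightarrow> 0"
    unfolding tendsto_iff_vabs
    by (rule Lim_null_comparison[rotated]) (use a_le in simp)
  moreover have "b \<longlonglongrightarrow> L"
    unfolding b_def M_def L_def u(2) by (rule power_quotient_tendsto_log[OF u(1)])
  ultimately have "(\<lambda>N. a N + (L - b N)) \<longlonglongrightarrow> 0 + (L - L)"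
    by (intro tendsto_intros)
  then have "(\<lambda>N. vabs (a N + (L - b N))) \<longlonglongrightarrow> 0"
    by (simp add: tendsto_iff_vabs)
  \<comment> \<open>Multiplied by |M|, both sides are |r^M - 1|. So a sequence tending to 0 is
    constant in absolute value.\<close>
  moreover have "vabs (a N + (L - b N)) = vabs (r - 1)" for N
  proof -
    have "vabs (M N) * vabs (r - 1) = vabs (r ^ (p ^ N) - 1)"
      unfolding vabs_power_minus_1[OF r] M_def ..
    also have "r ^ (p ^ N) - 1 = (padic_exp (M N * L) - q ^ (p ^ N)) / q ^ (p ^ N)"
      unfolding M_def padic_exp_of_nat_mult[OF L] r_def
      using \<open>q \<noteq> 0\<close> by (simp add: power_divide diff_divide_distrib)
    also have "padic_exp (M N * L) - q ^ (p ^ N) = M N * (a N + (L - b N))"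
      using M0[of N] by (simp add: a_def b_def field_simps)
    finally have "vabs (M N) * vabs (r - 1) = vabs (M N) * vabs (a N + (L - b N))"
      by (simp add: vabs_divide vabs_mult vabs_power q1)
    then show ?thesis
      using M0[of N] by simp
  qed
  ultimately have "vabs (r - 1) = 0"
    by (simp add: LIMSEQ_const_iff)
  then show ?thesis
    using \<open>q \<noteq> 0\<close> by (simp add: r_def L_def)
qed

section \<open>Powers of \<open>q\<close> and the \<open>q\<close>-integral\<close>

context
  fixes q :: 'a
  assumes q: "vabs (q - 1) < \<rho>"
begin

lemma vabs_log_less: "vabs (padic_log q) < \<rho>"
  using vabs_log_le[of "q - 1"] q by simp

lemma qpow_of_nat: "qpow q (of_nat k) = q ^ k"
  by (simp add: qpow_def padic_exp_of_nat_mult vabs_log_less padic_exp_log q)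

lemma qpow_add:
  assumes "vabs a \<le> 1" "vabs b \<le> 1"
  shows "qpow q (a + b) = qpow q a * qpow q b"
  unfolding qpow_def distrib_right
  by (intro padic_exp_add vabs_scaled_less assms vabs_log_less)

lemma qbracket_of_nat: "qbracket q (of_nat k) = (1 - q ^ k) / (1 - q)"
  by (simp add: qbracket_def qpow_of_nat)

lemma vabs_power_minus_1_less: "vabs (q ^ k - 1) < \<rho>"
proof -
  have "vabs (q ^ k - 1) \<le> 1 * vabs (q - 1)"
    unfolding vabs_power_minus_1[OF q] by (intro mult_right_mono) auto
  with q show ?thesis
    by simp
qed

text \<open>The disc contains no root of unity other than 1, because |q^k - 1| = |k| |q - 1| and the
  characteristic is 0. This keeps the denominators of the geometric sums nonzero.\<close>

lemma power_neq_1: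
  assumes "q \<noteq> 1" "k > 0"
  shows "q ^ k \<noteq> 1"
proof -
  have "vabs (q ^ k - 1) \<noteq> 0"
    unfolding vabs_power_minus_1[OF q] using assms by simp
  then show ?thesis
    by auto
qed

lemma power_p_power_tendsto_1: "(\<lambda>N. q ^ (p ^ N)) \<longlonglongrightarrow> 1"
  unfolding tendsto_iff_vabs vabs_power_minus_1[OF q]
  using tendsto_mult_right[OF p_power_tendsto_0, of "vabs (q - 1)"] by simp

end

text \<open>With T = Q^(p^N) each geometric sum is (1 - T^(l+1)) / (1 - Q^(l+1)), the weight Q^y
  having shifted l to l + 1. Dividing by [p^N]_Q = (1 - T) / (1 - Q) leaves the factor 1 + T + ... +
  T^l, which tends to l + 1 as T tends to 1.\<close>

lemma Qintegral_exponential_sum: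
  assumes Q: "vabs ((Q::'a) - 1) < \<rho>" "Q \<noteq> 1"
    and f: "\<And>y. f (of_nat y) = (\<Sum>l\<le>m. c l * (Q ^ l) ^ y)"
  shows "Qintegral p Q f = (\<Sum>l\<le>m. c l * (of_nat (Suc l) * ((1 - Q) / (1 - Q ^ Suc l))))"
  unfolding Qintegral_def
proof (rule limI)
  define g where "g N = (\<Sum>l\<le>m. c l * ((\<Sum>i<Suc l. (Q ^ i) ^ (p ^ N)) * ((1 - Q) / (1 - Q ^ Suc l))))"
    for N
  have "g \<longlonglongrightarrow> (\<Sum>l\<le>m. c l * ((\<Sum>i<Suc l. 1) * ((1 - Q) / (1 - Q ^ Suc l))))"
    unfolding g_def
    by (intro tendsto_intros power_p_power_tendsto_1 vabs_power_minus_1_less Q)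
  moreover have "1 / qbracket Q (of_nat (p ^ N)) * (\<Sum>y<p ^ N. f (of_nat y) * Q ^ y) = g N" for N
  proof -
    define T where "T = Q ^ (p ^ N)"
    have T: "T \<noteq> 1"
      unfolding T_def using p_ge_2 by (intro power_neq_1 Q) simp
    have "(\<Sum>y<p ^ N. f (of_nat y) * Q ^ y) = (\<Sum>y<p ^ N. \<Sum>l\<le>m. c l * (Q ^ Suc l) ^ y)"
      unfolding f sum_distrib_right by (simp add: power_mult_distrib mult_ac)
    also have "\<dots> = (\<Sum>l\<le>m. c l * (\<Sum>y<p ^ N. (Q ^ Suc l) ^ y))"
      by (subst sum.swap) (simp add: sum_distrib_left)
    also have "\<dots> = (\<Sum>l\<le>m. c l * ((1 - T ^ Suc l) / (1 - Q ^ Suc l)))"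
    proof (intro sum.cong refl)
      fix l
      have "Q ^ Suc l \<noteq> 1"
        by (intro power_neq_1 Q) simp
      then show "c l * (\<Sum>y<p ^ N. (Q ^ Suc l) ^ y) = c l * ((1 - T ^ Suc l) / (1 - Q ^ Suc l))"
        unfolding sum_gp_strict T_def by (simp only: power_commutes flip: power_mult) (simp add: mult.commute)
    qed
    also have "\<dots> = (\<Sum>l\<le>m. c l * ((1 - T) * (\<Sum>i<Suc l. T ^ i) / (1 - Q ^ Suc l)))"
      unfolding one_diff_power_eq ..
    finally have "1 / qbracket Q (of_nat (p ^ N)) * (\<Sum>y<p ^ N. f (of_nat y) * Q ^ y)
        = (1 - Q) / (1 - T) * (\<Sum>l\<le>m. c l * ((1 - T) * (\<Sum>i<Suc l. T ^ i) / (1 - Q ^ Suc l)))"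
      by (simp only: qbracket_of_nat[OF Q(1)] T_def) simp
    also have "\<dots> = (\<Sum>l\<le>m. c l * ((\<Sum>i<Suc l. T ^ i) * ((1 - Q) / (1 - Q ^ Suc l))))"
      unfolding sum_distrib_left[of "(1 - Q) / (1 - T)"]
    proof (intro sum.cong refl)
      fix l
      show "(1 - Q) / (1 - T) * (c l * ((1 - T) * (\<Sum>i<Suc l. T ^ i) / (1 - Q ^ Suc l)))
          = c l * ((\<Sum>i<Suc l. T ^ i) * ((1 - Q) / (1 - Q ^ Suc l)))"
        using T by simp
    qed
    also have "\<dots> = g N"
      unfolding g_def T_def by (simp only: mult.commute flip: power_mult)
    finally show ?thesis .
  qed
  ultimately show "(\<lambda>N. 1 / qbracket Q (of_nat (p ^ N)) * (\<Sum>y<p ^ N. f (of_nat y) * Q ^ y))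
      \<longlonglongrightarrow> (\<Sum>l\<le>m. c l * (of_nat (Suc l) * ((1 - Q) / (1 - Q ^ Suc l))))"
    by (simp del: sum.lessThan_Suc of_nat_Suc)
qed

section \<open>The symmetric closed form\<close>

text \<open>\<open>V j\<close> is P / w_j, written as a product to stay in the naturals. The
  right-hand side is free of \<sigma>, so comparing coefficients yields the theorem.\<close>

lemma fps_nth_A_series:
  fixes q x :: 'a and w \<sigma> :: "nat \<Rightarrow> nat"
  assumes q: "vabs (q - 1) < \<rho>" "q \<noteq> 1"
    and n: "n \<ge> 1" and w: "\<And>i. i \<in> {1..n} \<Longrightarrow> w i > 0"
    and x: "x \<in> Zp" and \<sigma>: "\<sigma> permutes {1..n}"
  defines "P \<equiv> \<Prod>i\<in>{1..n}. w i"
    and "V \<equiv> \<lambda>j. \<Prod>i\<in>{1..n} - {j}. w i"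
  shows "fps_nth (A_series p q n w x \<sigma>) m =
    (\<Sum>l\<le>m. of_nat (m choose l) * (-1) ^ l / ((1 - q) ^ m * fact m) * qpow q (of_nat P * x) ^ l *
       of_nat (Suc l) * (1 - q) * (1 - q ^ (Suc l * P)) ^ (n - 1) /
       (\<Prod>j\<in>{1..n}. 1 - q ^ (Suc l * V j)))"
proof -
  let ?I = "{1..n-1}"
  \<comment> \<open>The coefficient of Z^l in (1 - Z)^m / ((1 - q)^m m!).\<close>
  define d where "d l = of_nat (m choose l) * (-1) ^ l / ((1 - q) ^ m * fact m)" for l
  define X where "X = qpow q (of_nat P * x)"
  define W where "W = (\<Prod>l\<in>?I. w (\<sigma> l))"
  define e where "e k = w (\<sigma> n) * (\<Sum>j\<in>?I. (\<Prod>i\<in>?I - {j}. w (\<sigma> i)) * k j)" for k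
  define B where "B = (\<Pi>\<^sub>E j\<in>?I. {0..<w (\<sigma> j)})"
  define G where "G l = of_nat (Suc l) * ((1 - q ^ W) / (1 - (q ^ W) ^ Suc l))" for l
  have V_\<sigma>: "(\<Prod>i\<in>{1..n} - {j}. w (\<sigma> i)) = V (\<sigma> j)" for j
  proof -
    have "bij_betw \<sigma> ({1..n} - {j}) ({1..n} - {\<sigma> j})"
      using permutes_imp_bij[OF \<sigma>] permutes_inj[OF \<sigma>] permutes_image[OF \<sigma>]
      by (auto simp: bij_betw_def inj_on_diff image_set_diff)
    then show ?thesis
      unfolding V_def by (rule prod.reindex_bij_betw)
  qed
  have \<sigma>_in: "\<sigma> j \<in> {1..n}" if "j \<in> {1..n}" for j
    using permutes_in_image[OF \<sigma>] that by simp
  have V_pos: "V j > 0" for j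
    unfolding V_def by (intro prod_pos) (use w in auto)
  have V_w: "V j * w j = P" if "j \<in> {1..n}" for j
    unfolding V_def P_def using that by (subst prod.remove[of "{1..n}" j]) (simp_all add: mult.commute)
  have "?I = {1..n} - {n}"
    by auto
  then have W: "W = V (\<sigma> n)"
    unfolding W_def by (simp only: V_\<sigma>)
  \<comment> \<open>The outer factor supplies the index n that the inner product omits, so the
    exponent becomes a linear form in k with coefficients \<open>V (\<sigma> j)\<close>.\<close>
  have V_\<sigma>_I: "w (\<sigma> n) * (\<Prod>i\<in>?I - {j}. w (\<sigma> i)) = V (\<sigma> j)" if "j \<in> ?I" for j
  proof -
    have "{1..n} - {j} = insert n (?I - {j})" "n \<notin> ?I - {j}"
      using that by auto
    then show ?thesis
      unfolding V_\<sigma>[symmetric] by simp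
  qed
  have e: "e k = (\<Sum>j\<in>?I. V (\<sigma> j) * k j)" for k
    unfolding e_def sum_distrib_left mult.assoc[symmetric] by (intro sum.cong) (simp_all only: V_\<sigma>_I)
  have Q: "vabs (q ^ W - 1) < \<rho>" "q ^ W \<noteq> 1"
    using q V_pos by (auto simp: W vabs_power_minus_1_less power_neq_1)

  have integrand: "qbracket q (of_nat W * of_nat y + of_nat P * x + of_nat (e k)) ^ m / fact m
      = (\<Sum>l\<le>m. d l * X ^ l * (q ^ e k) ^ l * ((q ^ W) ^ l) ^ y)" for k y
  proof -
    define Z where "Z = q ^ (W * y) * X * q ^ e k"
    \<comment> \<open>\<open>qpow_add\<close> works on the closed unit ball, where the natural
      number summands lie anyway.\<close>
    have x1: "vabs (of_nat P * x) \<le> 1"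
      unfolding vabs_mult using vabs_Zp_le_1[OF x] by (intro mult_le_one) auto
    then have "qpow q (of_nat (W * y) + of_nat P * x + of_nat (e k)) = Z"
      unfolding Z_def X_def qpow_of_nat[OF q(1), symmetric]
      by (subst qpow_add[OF q(1)] | simp add: vabs_add_bound del: of_nat_mult)+
    then have "qbracket q (of_nat W * of_nat y + of_nat P * x + of_nat (e k)) ^ m / fact m
        = (- Z + 1) ^ m / ((1 - q) ^ m * fact m)"
      by (simp add: qbracket_def power_divide)
    also have "\<dots> = (\<Sum>l\<le>m. d l * Z ^ l)"
      unfolding binomial_ring sum_divide_distrib d_def
      by (intro sum.cong refl) (simp add: power_minus[of Z])
    also have "\<dots> = (\<Sum>l\<le>m. d l * X ^ l * (q ^ e k) ^ l * ((q ^ W) ^ l) ^ y)"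
      unfolding Z_def
      by (intro sum.cong refl) (simp add: power_mult_distrib mult_ac flip: power_mult)
    finally show ?thesis .
  qed

  \<comment> \<open>The exponent is linear in k, so the sum over tuples factors into geometric sums.
    The j-th has \<open>w (\<sigma> j)\<close> terms, and
    \<open>V (\<sigma> j) * w (\<sigma> j) = P\<close> makes all numerators agree.\<close>
  have tuples: "(\<Sum>k\<in>B. (q ^ e k) ^ Suc l)
      = (1 - q ^ (Suc l * P)) ^ (n - 1) / (\<Prod>j\<in>?I. 1 - q ^ (Suc l * V (\<sigma> j)))" for l
  proof -
    have "(\<Sum>k\<in>B. (q ^ e k) ^ Suc l) = (\<Sum>k\<in>B. \<Prod>j\<in>?I. (q ^ (Suc l * V (\<sigma> j))) ^ k j)"
      by (simp only: e power_mult[symmetric] power_sum[symmetric] sum_distrib_left sum_distrib_right mult_ac)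
    also have "\<dots> = (\<Prod>j\<in>?I. \<Sum>i\<in>{0..<w (\<sigma> j)}. (q ^ (Suc l * V (\<sigma> j))) ^ i)"
      unfolding B_def by (subst prod_sum_PiE) auto
    also have "\<dots> = (\<Prod>j\<in>?I. (1 - q ^ (Suc l * P)) / (1 - q ^ (Suc l * V (\<sigma> j))))"
    proof (intro prod.cong refl)
      fix j assume "j \<in> ?I"
      then have P: "V (\<sigma> j) * w (\<sigma> j) = P"
        by (intro V_w \<sigma>_in) auto
      have "q ^ (Suc l * V (\<sigma> j)) \<noteq> 1"
        using V_pos by (intro power_neq_1 q) simp
      then show "(\<Sum>i\<in>{0..<w (\<sigma> j)}. (q ^ (Suc l * V (\<sigma> j))) ^ i)
          = (1 - q ^ (Suc l * P)) / (1 - q ^ (Suc l * V (\<sigma> j)))"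
        unfolding atLeast0LessThan sum_gp_strict P[symmetric]
        by (simp only: if_False power_mult mult.assoc)
    qed
    finally show ?thesis
      by (simp add: prod_dividef)
  qed

  have "fps_nth (A_series p q n w x \<sigma>) m
      = 1 / qbracket q (of_nat W) * (\<Sum>k\<in>B. q ^ e k * Qintegral p (q ^ W) (\<lambda>y.
          qbracket q (of_nat W * y + of_nat P * x + of_nat (e k)) ^ m / fact m))"
    unfolding A_series_def Let_def fps_Qintegral_def
    unfolding W_def[symmetric] e_def[symmetric] P_def[symmetric] B_def[symmetric]
    by (simp add: fps_sum_nth)
  also have "\<dots> = (1 - q) / (1 - q ^ W)
      * (\<Sum>k\<in>B. q ^ e k * (\<Sum>l\<le>m. d l * X ^ l * (q ^ e k) ^ l * G l))"
    unfolding G_def qbracket_of_nat[OF q(1)]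
    by (simp only: Qintegral_exponential_sum[OF Q integrand]) simp
  \<comment> \<open>Exchanging the sums merges the prefactor q^(e k) with its l-th power, giving the
    same exponent l + 1 as in the integral.\<close>
  also have "\<dots> = (\<Sum>l\<le>m. (1 - q) / (1 - q ^ W) * (d l * X ^ l * G l * (\<Sum>k\<in>B. (q ^ e k) ^ Suc l)))"
    unfolding sum_distrib_left by (subst sum.swap) (simp add: mult_ac)
  also have "\<dots> = (\<Sum>l\<le>m. d l * X ^ l * of_nat (Suc l) * (1 - q) * (1 - q ^ (Suc l * P)) ^ (n - 1) /
       (\<Prod>j\<in>{1..n}. 1 - q ^ (Suc l * V j)))"
  proof (intro sum.cong refl)
    fix l
    let ?v = "\<lambda>j. 1 - q ^ (Suc l * V j)"
    \<comment> \<open>\<sigma> merely reorders this product. Its factor at j = n is the denominator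
      of the integral, as \<open>W = V (\<sigma> n)\<close>; the others come from the
      tuples.\<close>
    have "(\<Prod>j\<in>{1..n}. ?v j) = (\<Prod>j\<in>{1..n}. ?v (\<sigma> j))"
      using permutes_imp_bij[OF \<sigma>] by (rule prod.reindex_bij_betw[symmetric])
    also have "\<dots> = (\<Prod>j\<in>insert n ?I. ?v (\<sigma> j))"
      using n by (intro prod.cong) auto
    also have "\<dots> = (1 - (q ^ W) ^ Suc l) * (\<Prod>j\<in>?I. ?v (\<sigma> j))"
      using n by (subst prod.insert) (auto simp: W power_mult[symmetric] mult.commute simp del: power_Suc)
    finally have "(\<Prod>j\<in>{1..n}. ?v j) = (1 - (q ^ W) ^ Suc l) * (\<Prod>j\<in>?I. ?v (\<sigma> j))" .
    \<comment> \<open>The factor 1 - q^W from the bracket of W cancels the numerator of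
      \<open>G l\<close>.\<close>
    then show "(1 - q) / (1 - q ^ W) * (d l * X ^ l * G l * (\<Sum>k\<in>B. (q ^ e k) ^ Suc l))
        = d l * X ^ l * of_nat (Suc l) * (1 - q) * (1 - q ^ (Suc l * P)) ^ (n - 1) / (\<Prod>j\<in>{1..n}. ?v j)"
      using Q(2) by (simp only: tuples G_def) simp
  qed
  finally show ?thesis
    unfolding d_def X_def .
qed

end

theorem theorem2p1:
  fixes p n :: nat
    and q x :: "'a::complete_nonarch_field"
    and w \<sigma> \<tau> :: "nat \<Rightarrow> nat"
  assumes "is_Cp TYPE('a) p"
    and "q \<noteq> 1"
    and "vabs (1 - q) < real p powr (- 1 / (real p - 1))"
    and "n \<ge> 1"
    and "\<And>i. i \<in> {1..n} \<Longrightarrow> w i > 0"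
    and "x \<in> Zp"
    and "\<sigma> permutes {1..n}"
    and "\<tau> permutes {1..n}"
  shows "A_series p q n w x \<sigma> = A_series p q n w x \<tau>"
proof -
  interpret padic_valued p "TYPE('a)"
    using assms(1) by unfold_locales (auto simp: is_Cp_def)
  have "vabs (q - 1) < \<rho>"
    using assms(3) by (simp add: \<rho>_def vabs_diff_commute)
  note coeff = fps_nth_A_series[OF this assms(2,4,5,6)]
  show ?thesis
    by (rule fps_ext) (simp only: coeff[OF _ assms(7)] coeff[OF _ assms(8)])
qed

end
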